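(* Let $Y$ be a Bernoulli random variable with probability of success $p$. For all integers $n\ge 0$ (and $0\le k\le n$), $$H_{n,\lambda}^{Y}(x)=H_{n,\lambda}(xp),\qquad H_{\lambda}^{Y}(n,k)=p^{k}H_{\lambda}(n,k).$$
   Context: Fix a nonzero real $\lambda$. Put $\langle x\rangle_{0,\lambda}=1$, $\langle x\rangle_{n,\lambda}=x(x+\lambda)\cdots(x+(n-1)\lambda)$, and for real $a$ let $e_\lambda^{-a}(-t)=(1-\lambda t)^{-a/\lambda}=\sum_{n\ge0}\langle a\rangle_{n,\lambda}t^n/n!$. The probabilistic heterogeneous Stirling numbers of the second kind associated with $Y$ are defined by $\frac{1}{k!}(E[e_{\lambda}^{-Y}(-t)]-1)^{k}=\sum_{n\ge k}H_{\lambda}^{Y}(n,k)t^{n}/n!$, and the probabilistic heterogeneous Bell polynomials by $e^{x(E[e_{\lambda}^{-Y}(-t)]-1)}=\sum_{n\ge0}H_{n,\lambda}^{Y}(x)t^{n}/n!$. The heterogeneous Stirling numbers of the second kind $H_\lambda(n,k)$ are defined by $\frac{1}{k!}(e_{\lambda}^{-1}(-t)-1)^{k}=\sum_{n\ge k}H_{\lambda}(n,k)\frac{t^{n}}{n!}$, and the heterogeneous Bell polynomials by $e^{x(e_{\lambda}^{-1}(-t)-1)}=\sum_{n\ge0}H_{n,\lambda}(x)\frac{t^{n}}{n!}$. *)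

theory Defs
  imports "HOL-Probability.Probability" "HOL-Complex_Analysis.Complex_Analysis"
begin

text \<open>
  Generating functions are read as identities between functions of a real variable \<open>t\<close> near \<open>0\<close>:
  \<open>egf_coeff f n\<close> is the coefficient of \<open>t ^ n / n!\<close> in the power series with positive radius of
  convergence that represents \<open>f\<close> near \<open>0\<close>. It is unique if it exists (\<open>egf_coeff_eqI\<close>); that it
  exists for the heterogeneous Stirling numbers and Bell polynomials is shown at the end.
\<close>

definition egf_coeff :: "(real \<Rightarrow> real) \<Rightarrow> nat \<Rightarrow> real" where
  "egf_coeff f n = fact n * fps_nth (THE F. f has_fps_expansion F) n"

text \<open>\<open>deg_exp lam a t\<close> is $e_\lambda^{-a}(-t) = (1 - \lambda t)^{-a/\lambda}$, meaningful for $\lambda t < 1$.\<close>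

definition deg_exp :: "real \<Rightarrow> real \<Rightarrow> real \<Rightarrow> real" where
  "deg_exp lam a t = (1 - lam * t) powr (- a / lam)"

definition rising_fact :: "real \<Rightarrow> real \<Rightarrow> nat \<Rightarrow> real" where
  "rising_fact lam x n = (\<Prod>i<n. x + real i * lam)"

definition het_stirling :: "real \<Rightarrow> nat \<Rightarrow> nat \<Rightarrow> real" where
  "het_stirling lam n k = egf_coeff (\<lambda>t. 1 / fact k * (deg_exp lam 1 t - 1) ^ k) n"

definition het_bell :: "real \<Rightarrow> nat \<Rightarrow> real \<Rightarrow> real" where
  "het_bell lam n x = egf_coeff (\<lambda>t. exp (x * (deg_exp lam 1 t - 1))) n"

definition prob_het_stirling ::
    "'a measure \<Rightarrow> ('a \<Rightarrow> real) \<Rightarrow> real \<Rightarrow> nat \<Rightarrow> nat \<Rightarrow> real" where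
  "prob_het_stirling M Y lam n k =
     egf_coeff (\<lambda>t. 1 / fact k * (prob_space.expectation M (\<lambda>\<omega>. deg_exp lam (Y \<omega>) t) - 1) ^ k) n"

definition prob_het_bell ::
    "'a measure \<Rightarrow> ('a \<Rightarrow> real) \<Rightarrow> real \<Rightarrow> nat \<Rightarrow> real \<Rightarrow> real" where
  "prob_het_bell M Y lam n x =
     egf_coeff (\<lambda>t. exp (x * (prob_space.expectation M (\<lambda>\<omega>. deg_exp lam (Y \<omega>) t) - 1))) n"

lemma has_fps_expansion_unique_real:
  fixes f :: "real \<Rightarrow> real"
  assumes "f has_fps_expansion F" "f has_fps_expansion G"
  shows   "F = G"
proof (rule ccontr)
  assume "F \<noteq> G"
  define D where "D = F - G"
  have D: "(\<lambda>t. f t - f t) has_fps_expansion D"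
    unfolding D_def by (intro has_fps_expansion_diff assms)
  from D have rad: "fps_conv_radius D > 0"
    and ev: "eventually (\<lambda>t. eval_fps D t = 0) (nhds 0)"
    by (auto simp: has_fps_expansion_def)
  from ev have D0: "eval_fps D 0 = 0"
    by (rule eventually_nhds_x_imp_x)
  have "D \<noteq> 0" using \<open>F \<noteq> G\<close> by (simp add: D_def)
  then obtain m where m: "fps_nth D m \<noteq> 0" by (auto simp: fps_eq_iff)
  with D0 have "m > 0" by (cases m) (auto simp: eval_fps_at_0)
  obtain r :: real where r: "r > 0" "ereal r < fps_conv_radius D"
    using rad ereal_dense2[of 0 "fps_conv_radius D"] by (auto simp: zero_ereal_def)
  have sm: "(\<lambda>n. fps_nth D n * (x - 0) ^ n) sums eval_fps D x" if "norm (x - 0) < r" for x :: real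
    using sums_eval_fps[of x D] that r by (simp add: less_trans[of "ereal \<bar>x\<bar>" "ereal r"])
  obtain s where s: "0 < s" "\<And>z. z \<in> cball 0 s - {0} \<Longrightarrow> eval_fps D z \<noteq> 0"
    using powser_0_nonzero[OF r(1) sm D0 m \<open>m > 0\<close>] by blast
  obtain e where e: "e > 0" "\<And>t. dist t 0 < e \<Longrightarrow> eval_fps D t = 0"
    using ev by (auto simp: eventually_nhds_metric)
  define z where "z = min s (e / 2)"
  have "z \<in> cball 0 s - {0}" "dist z 0 < e"
    using s(1) e(1) by (auto simp: z_def)
  with s(2) e(2) show False by blast
qed

lemma egf_coeff_eqI:
  assumes "f has_fps_expansion F"
  shows   "egf_coeff f n = fact n * fps_nth F n"
proof -
  have "(THE F. f has_fps_expansion F) = F"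
    using assms has_fps_expansion_unique_real by blast
  thus ?thesis by (simp add: egf_coeff_def)
qed

lemma egf_coeff_sums:
  assumes "f has_fps_expansion F"
  shows   "eventually (\<lambda>t. (\<lambda>n. egf_coeff f n * t ^ n / fact n) sums f t) (nhds 0)"
proof -
  have rad: "fps_conv_radius F > 0" and ev: "eventually (\<lambda>t. eval_fps F t = f t) (nhds 0)"
    using assms by (auto simp: has_fps_expansion_def)
  have "eventually (\<lambda>t. t \<in> eball 0 (fps_conv_radius F)) (nhds (0 :: real))"
    using rad by (intro eventually_nhds_in_open) (auto simp: zero_ereal_def)
  with ev show ?thesis
  proof eventually_elim
    case (elim t)
    hence "(\<lambda>n. fps_nth F n * t ^ n) sums f t"
      using sums_eval_fps[of t F] by (simp add: in_eball_iff)
    thus ?case by (simp add: egf_coeff_eqI[OF assms])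
  qed
qed

lemma rising_fact_gbinomial:
  assumes "lam \<noteq> 0"
  shows   "((- a / lam) gchoose n) * (- lam) ^ n = rising_fact lam a n / fact n"
proof -
  have "pochhammer (a / lam) n * lam ^ n = rising_fact lam a n"
  proof (induction n)
    case (Suc n)
    have "pochhammer (a / lam) (Suc n) * lam ^ Suc n
        = (pochhammer (a / lam) n * lam ^ n) * ((a / lam + real n) * lam)"
      by (simp add: pochhammer_Suc)
    also have "(a / lam + real n) * lam = a + real n * lam"
      using assms by (simp add: field_simps)
    finally show ?case by (simp add: Suc.IH rising_fact_def)
  qed (simp add: rising_fact_def)
  moreover have "(- 1) ^ n * pochhammer (a / lam) n * (- lam) ^ n = pochhammer (a / lam) n * lam ^ n"
    by (simp add: mult.commute flip: power_mult_distrib mult.assoc)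
  ultimately show ?thesis
    by (simp add: gbinomial_pochhammer)
qed

lemma deg_exp_sums:
  assumes "lam \<noteq> 0" "\<bar>lam * t\<bar> < 1"
  shows   "(\<lambda>n. rising_fact lam a n * t ^ n / fact n) sums deg_exp lam a t"
proof -
  have "(\<lambda>n. ((- a / lam) gchoose n) * (- lam * t) ^ n) sums (1 + (- lam * t)) powr (- a / lam)"
    by (rule gen_binomial_real) (use assms in simp)
  moreover have "((- a / lam) gchoose n) * (- lam * t) ^ n = rising_fact lam a n * t ^ n / fact n" for n
  proof -
    have "((- a / lam) gchoose n) * (- lam * t) ^ n = (((- a / lam) gchoose n) * (- lam) ^ n) * t ^ n"
      by (simp only: power_mult_distrib mult.assoc)
    thus ?thesis by (simp only: rising_fact_gbinomial[OF assms(1)]) simp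
  qed
  ultimately show ?thesis
    by (simp add: deg_exp_def)
qed

lemma has_fps_expansion_of_analytic:
  fixes f :: "real \<Rightarrow> real"
  assumes "g analytic_on {0}"
    and "eventually (\<lambda>t. g (complex_of_real t) = complex_of_real (f t)) (nhds 0)"
  shows   "\<exists>F. f has_fps_expansion F"
proof -
  define G where "G = fps_expansion g 0"
  have G: "g has_fps_expansion G"
    unfolding G_def by (rule analytic_at_imp_has_fps_expansion_0) fact
  have "eventually (\<lambda>z. z \<in> eball 0 (fps_conv_radius G)) (nhds (0 :: complex))"
    using G by (intro eventually_nhds_in_open) (auto simp: has_fps_expansion_def zero_ereal_def)
  moreover have "eventually (\<lambda>z. eval_fps G z = g z) (nhds 0)"
    using G by (simp add: has_fps_expansion_def)
  ultimately have "eventually (\<lambda>z. (\<lambda>n. fps_nth G n * z ^ n) sums g z) (nhds 0)"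
    by eventually_elim (metis in_eball_iff dist_0_norm sums_eval_fps)
  moreover have "filterlim complex_of_real (nhds 0) (nhds 0)"
    using tendsto_of_real[OF filterlim_ident, of "0 :: real"] by simp
  ultimately have "eventually (\<lambda>t. (\<lambda>n. fps_nth G n * complex_of_real t ^ n) sums g (complex_of_real t)) (nhds 0)"
    by (rule eventually_compose_filterlim)
  with assms(2) have "eventually (\<lambda>t. (\<lambda>n. Re (fps_nth G n) * t ^ n) sums f t) (nhds 0)"
  proof eventually_elim
    case (elim t)
    hence "(\<lambda>n. Re (fps_nth G n * complex_of_real t ^ n)) sums Re (complex_of_real (f t))"
      by (intro sums_Re) simp
    thus ?case by (simp flip: of_real_power)
  qed
  hence "f has_fps_expansion Abs_fps (\<lambda>n. Re (fps_nth G n))"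
    by (intro has_fps_expansionI) simp
  thus ?thesis by blast
qed

lemma eventually_less_1_nhds_0: "eventually (\<lambda>t. lam * t < 1) (nhds (0 :: real))"
proof -
  have "((\<lambda>t. lam * t) \<longlongrightarrow> lam * 0) (nhds 0)"
    by (intro tendsto_intros filterlim_ident)
  thus ?thesis by (rule order_tendstoD(2)) simp
qed

lemma het_bell_sums:
  "eventually (\<lambda>t. (\<lambda>n. het_bell lam n x * t ^ n / fact n) sums exp (x * (deg_exp lam 1 t - 1))) (nhds 0)"
proof -
  have "\<exists>F. (\<lambda>t. exp (x * (deg_exp lam 1 t - 1))) has_fps_expansion F"
  proof (rule has_fps_expansion_of_analytic)
    show "(\<lambda>z. exp (of_real x * ((1 - of_real lam * z) powr of_real (- 1 / lam) - 1))) analytic_on {0}"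
      by (auto intro!: analytic_intros)
    show "eventually (\<lambda>t. exp (of_real x * ((1 - of_real lam * complex_of_real t) powr of_real (- 1 / lam) - 1))
            = complex_of_real (exp (x * (deg_exp lam 1 t - 1)))) (nhds 0)"
      using eventually_less_1_nhds_0[of lam]
    proof eventually_elim
      case (elim t)
      have "(1 - of_real lam * complex_of_real t) powr of_real (- 1 / lam) = of_real (deg_exp lam 1 t)"
        using elim powr_of_real[of "1 - lam * t" "- 1 / lam"] by (simp add: deg_exp_def)
      thus ?case by (simp flip: exp_of_real)
    qed
  qed
  thus ?thesis unfolding het_bell_def using egf_coeff_sums by blast
qed

lemma het_stirling_sums:
  "eventually (\<lambda>t. (\<lambda>n. het_stirling lam n k * t ^ n / fact n) sums
     (1 / fact k * (deg_exp lam 1 t - 1) ^ k)) (nhds 0)"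
proof -
  have "\<exists>F. (\<lambda>t. 1 / fact k * (deg_exp lam 1 t - 1) ^ k) has_fps_expansion F"
  proof (rule has_fps_expansion_of_analytic)
    show "(\<lambda>z. 1 / fact k * ((1 - of_real lam * z) powr of_real (- 1 / lam) - 1) ^ k) analytic_on {0}"
      by (auto intro!: analytic_intros)
    show "eventually (\<lambda>t. 1 / fact k * ((1 - of_real lam * complex_of_real t) powr of_real (- 1 / lam) - 1) ^ k
            = complex_of_real (1 / fact k * (deg_exp lam 1 t - 1) ^ k)) (nhds 0)"
      using eventually_less_1_nhds_0[of lam]
    proof eventually_elim
      case (elim t)
      have "(1 - of_real lam * complex_of_real t) powr of_real (- 1 / lam) = of_real (deg_exp lam 1 t)"
        using elim powr_of_real[of "1 - lam * t" "- 1 / lam"] by (simp add: deg_exp_def)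
      thus ?case by simp
    qed
  qed
  thus ?thesis unfolding het_stirling_def using egf_coeff_sums by blast
qed

end

theory Submission
  imports Defs
begin

text \<open>
  Since \<open>Y\<close> is almost surely \<open>0\<close> or \<open>1\<close>, the mean of $e_\lambda^{-Y}(-t) - 1$ equals
  $p\,(e_\lambda^{-1}(-t) - 1)$ for $t$ near $0$. Hence the two Bell generating functions agree near
  $0$ after replacing $x$ by $xp$, and the Stirling ones differ by the factor $p^k$.
\<close>

text \<open>Having a given expansion depends only on the germ at 0, so both \<open>THE\<close> terms
  describe the same series. The argument works even where no expansion is known to exist.\<close>

lemma egf_coeff_cong:
  assumes "eventually (\<lambda>t. f t = g t) (nhds 0)"
  shows   "egf_coeff f n = egf_coeff g n"
proof -
  have "f has_fps_expansion F \<longleftrightarrow> g has_fps_expansion F" for F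
    using assms by (rule has_fps_expansion_cong) simp
  thus ?thesis by (simp add: egf_coeff_def)
qed

text \<open>An expansion of \<open>f\<close> is assumed because otherwise the \<open>THE\<close> in
  \<open>egf_coeff\<close> is unspecified and need not scale with \<open>c\<close>.\<close>

lemma egf_coeff_cmult:
  assumes "f has_fps_expansion F"
  shows   "egf_coeff (\<lambda>t. c * f t) n = c * egf_coeff f n"
  using egf_coeff_eqI[OF has_fps_expansion_cmult_left[OF assms, of c]] egf_coeff_eqI[OF assms]
  by simp

lemma (in prob_space) expectation_bernoulli:
  fixes Y :: "'a \<Rightarrow> real" and h :: "real \<Rightarrow> real"
  assumes [measurable]: "Y \<in> borel_measurable M" "h \<in> borel_measurable borel"
    and p1: "prob {\<omega> \<in> space M. Y \<omega> = 1} = p"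
    and p0: "prob {\<omega> \<in> space M. Y \<omega> = 0} = 1 - p"
  shows "expectation (\<lambda>\<omega>. h (Y \<omega>)) = p * h 1 + (1 - p) * h 0"
proof -
  define A where "A = {\<omega> \<in> space M. Y \<omega> = 1}"
  define B where "B = {\<omega> \<in> space M. Y \<omega> = 0}"
  have [measurable]: "A \<in> events" "B \<in> events"
    by (auto simp: A_def B_def)
  have "prob (A \<union> B) = prob A + prob B"
    by (rule finite_measure_Union) (auto simp: A_def B_def)
  hence "prob (A \<union> B) = 1"
    using p1 p0 by (simp add: A_def B_def)
  hence ae: "AE \<omega> in M. \<omega> \<in> A \<union> B"
    using AE_in_set_eq_1[of "A \<union> B"] by simp
  \<comment> \<open>A simple function that agrees with \<open>h (Y \<omega>)\<close> on the almost
    sure event \<open>A \<union> B\<close>. Its integral is read off from the two masses.\<close>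
  define g where "g = (\<lambda>\<omega>. h 1 * indicator A \<omega> + h 0 * indicator B \<omega>)"
  have eq: "h (Y \<omega>) = g \<omega>" if "\<omega> \<in> A \<union> B" for \<omega>
    using that by (auto simp: g_def A_def B_def)
  have "expectation (\<lambda>\<omega>. h (Y \<omega>)) = expectation g"
    using ae eq by (intro integral_cong_AE) (auto simp: g_def)
  also have "\<dots> = h 1 * prob A + h 0 * prob B"
    unfolding g_def by (subst Bochner_Integration.integral_add) (auto simp: emeasure_eq_measure)
  also have "\<dots> = p * h 1 + (1 - p) * h 0"
    using p1 p0 by (simp flip: A_def B_def)
  finally show ?thesis .
qed

theorem theorem2p18:
  fixes M :: "'a measure" and Y :: "'a \<Rightarrow> real" and p lam :: real
  assumes "lam \<noteq> 0"
    and "prob_space M"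
    and "Y \<in> borel_measurable M"
    and "0 \<le> p" and "p \<le> 1"
    and "measure M {\<omega> \<in> space M. Y \<omega> = 1} = p"
    and "measure M {\<omega> \<in> space M. Y \<omega> = 0} = 1 - p"
  shows "(\<forall>n x. prob_het_bell M Y lam n x = het_bell lam n (x * p)) \<and>
         (\<forall>n k. k \<le> n \<longrightarrow> prob_het_stirling M Y lam n k = p ^ k * het_stirling lam n k)"
proof -
  interpret prob_space M by fact
  have mean: "eventually (\<lambda>t. expectation (\<lambda>\<omega>. deg_exp lam (Y \<omega>) t) - 1 = p * (deg_exp lam 1 t - 1)) (nhds 0)"
    using eventually_less_1_nhds_0[of lam]
  proof eventually_elim
    case (elim t)
    have "expectation (\<lambda>\<omega>. deg_exp lam (Y \<omega>) t) = p * deg_exp lam 1 t + (1 - p) * deg_exp lam 0 t"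
      using assms by (intro expectation_bernoulli) (auto simp: deg_exp_def)
    \<comment> \<open>Since \<open>0 powr 0 = 0\<close>, the base \<open>1 - lam * t\<close> must be
      nonzero; \<open>lam * t < 1\<close> ensures this.\<close>
    moreover have "deg_exp lam 0 t = 1"
      using elim by (simp add: deg_exp_def)
    ultimately show ?case by (simp add: algebra_simps)
  qed
  have "prob_het_bell M Y lam n x = het_bell lam n (x * p)" for n x
    unfolding prob_het_bell_def het_bell_def
    by (rule egf_coeff_cong) (use mean in eventually_elim, simp)
  moreover have "prob_het_stirling M Y lam n k = p ^ k * het_stirling lam n k" for n k
  proof -
    let ?f = "\<lambda>t. 1 / fact k * (deg_exp lam 1 t - 1) ^ k"
    \<comment> \<open>Pulling out \<open>p ^ k\<close> requires an actual expansion. The convergent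
      series of the Stirling numbers themselves provides it.\<close>
    have F: "?f has_fps_expansion Abs_fps (\<lambda>n. het_stirling lam n k / fact n)"
      using het_stirling_sums[of lam k] by (intro has_fps_expansionI) simp
    have "prob_het_stirling M Y lam n k = egf_coeff (\<lambda>t. p ^ k * ?f t) n"
      unfolding prob_het_stirling_def
      by (rule egf_coeff_cong)
        (use mean in eventually_elim, simp add: power_mult_distrib)
    also have "\<dots> = p ^ k * het_stirling lam n k"
      unfolding het_stirling_def by (rule egf_coeff_cmult) (rule F)
    finally show ?thesis .
  qed
  ultimately show ?thesis by blast
qed

end
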